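(* Let $(\mathcal S,\mathcal O,\mathcal A,\alpha,\beta,r)$ be a finite partially observable Markov decision process with discount factor $\gamma\in(0,1)$ and initial state distribution $\mu\in\Delta_{\mathcal S}$. Assume that the observation kernel is deterministic, i.e. $\beta\in\Delta_{\mathcal O}^{\mathcal S}\cap\{0,1\}^{\mathcal O\times\mathcal S}$, and let $g_\beta\colon\mathcal S\to\mathcal O$ be the corresponding map, so that $\beta(o|s)=1$ if and only if $g_\beta(s)=o$. Assume further (positivity) that $\sum_{a\in\mathcal A}\eta^\pi_{sa}>0$ for every $s\in\mathcal S$ and every policy $\pi\in\Delta_{\mathcal A}^{\mathcal O}$, where $\eta^\pi=\Phi(\pi)$ is the discounted state-action frequency of $\pi$. Then the set of feasible state-action frequencies satisfies $$\Phi(\Delta_{\mathcal A}^{\mathcal O})=\mathcal L\cap\mathcal X\cap\Delta_{\mathcal S\times\mathcal A},$$ where $$\mathcal L=\Big\{\eta\in\mathbb R^{\mathcal S\times\mathcal A}:\ \sum_{a}\eta_{sa}-\gamma\sum_{s',a'}\eta_{s'a'}\,\alpha(s|s',a')-(1-\gamma)\mu_s=0\ \text{ for all } s\in\mathcal S\Big\}$$ and $$\mathcal X=\Big\{\eta\in\mathbb R^{\mathcal S\times\mathcal A}:\ \eta_{sa}\eta_{s'a'}-\eta_{sa'}\eta_{s'a}=0\ \text{ for all } a,a'\in\mathcal A \text{ and all } s,s'\in\mathcal S \text{ with } g_\beta(s)=g_\beta(s')\Big\}.$$ In particular, in this description of $\Phi(\Delta_{\mathcal A}^{\mathcal O})$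 by polynomial equations and inequalities, the only inequalities are of the form $\eta_{sa}\ge 0$.
   Context: For a finite set $\mathcal X_0$, $\Delta_{\mathcal X_0}=\{\mu\in\mathbb R^{\mathcal X_0}:\mu\ge0,\ \sum_x\mu_x=1\}$ is the probability simplex. For finite sets $\mathcal X_0,\mathcal Y_0$, $\Delta_{\mathcal Y_0}^{\mathcal X_0}$ is the set of Markov kernels from $\mathcal X_0$ to $\mathcal Y_0$, i.e. column-stochastic matrices $Q\in\mathbb R^{\mathcal Y_0\times\mathcal X_0}$ with entries $Q(y|x)=Q_{yx}$; composition of kernels is matrix multiplication. For $p\in\Delta_{\mathcal X_0}$ and $Q\in\Delta_{\mathcal Y_0}^{\mathcal X_0}$, $p\ast Q\in\Delta_{\mathcal X_0\times\mathcal Y_0}$ is defined by $(p\ast Q)(x,y)=p(x)Q(y|x)$. A finite partially observable Markov decision process (POMDP) is a tuple $(\mathcal S,\mathcal O,\mathcal A,\alpha,\beta,r)$ where $\mathcal S$ (states), $\mathcal O$ (observations), $\mathcal A$ (actions) are finite sets, $\alpha\in\Delta_{\mathcal S}^{\mathcal S\times\mathcal A}$ is the transition kernel, $\beta\in\Delta_{\mathcal O}^{\mathcal S}$ is the observation kernel, and $r\in\mathbb R^{\mathcal S\times\mathcal A}$ is the instantaneous reward vector. A (memoryless stochastic) policy is an element $\pi\in\Delta_{\mathcal A}^{\mathcal O}$. It defines the state-action transition kernel $P_{\pi\circ\beta}\in\Delta_{\mathcal S\times\mathcal A}^{\mathcal S\times\mathcal A}$ with entries $P_{\pi\circ\beta}(s',a'|s,a)=\alpha(s'|s,a)\,(\pi\circ\beta)(a'|s')$.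 The discounted state-action frequency of $\pi$ is $$\Phi(\pi)=\eta^\pi=(1-\gamma)\sum_{t\ge0}\gamma^tP_{\pi\circ\beta}^t(\mu\ast(\pi\circ\beta))=(1-\gamma)(I-\gamma P_{\pi\circ\beta})^{-1}(\mu\ast(\pi\circ\beta))\in\Delta_{\mathcal S\times\mathcal A},$$ which defines a map $\Phi\colon\Delta_{\mathcal A}^{\mathcal O}\to\Delta_{\mathcal S\times\mathcal A}$. *)

theory Defs
  imports "HOL-Analysis.Analysis"
begin

definition prob_simplex :: "(real ^ 'x) set" where
  "prob_simplex = {p. (\<forall>x. 0 \<le> p $ x) \<and> (\<Sum>x\<in>UNIV. p $ x) = 1}"

text \<open>A kernel from \<open>'x\<close> to \<open>'y\<close> is a column-stochastic matrix with rows indexed by \<open>'y\<close>: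
  \<open>Q $ y $ x\<close> is $Q(y|x)$, so that composition of kernels is \<open>(**)\<close>.\<close>

definition markov_kernels :: "(real ^ 'x ^ 'y) set" where
  "markov_kernels = {Q. \<forall>x. column x Q \<in> prob_simplex}"

definition joint_distribution :: "real ^ 'x \<Rightarrow> real ^ 'x ^ 'y \<Rightarrow> real ^ ('x \<times> 'y)" where
  "joint_distribution p Q = (\<chi> z. p $ fst z * Q $ snd z $ fst z)"

text \<open>The library has no power operation for the matrix product \<open>(**)\<close>.\<close>

primrec matrix_power :: "real ^ 'n ^ 'n \<Rightarrow> nat \<Rightarrow> real ^ 'n ^ 'n" where
  "matrix_power P 0 = mat 1"
| "matrix_power P (Suc t) = P ** matrix_power P t"

record ('s, 'o, 'a) pomdp =
  transition :: "real ^ ('s \<times> 'a) ^ 's"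
  observation :: "real ^ 's ^ 'o"
  reward :: "real ^ ('s \<times> 'a)"

text \<open>The reward vector is arbitrary, hence unconstrained.\<close>

definition is_pomdp :: "('s::finite, 'o::finite, 'a::finite) pomdp \<Rightarrow> bool" where
  "is_pomdp M \<longleftrightarrow> transition M \<in> markov_kernels \<and> observation M \<in> markov_kernels"

definition policies :: "('s::finite, 'o::finite, 'a::finite) pomdp \<Rightarrow> (real ^ 'o ^ 'a) set" where
  "policies M = markov_kernels"

definition state_action_kernel ::
    "('s::finite, 'o::finite, 'a::finite) pomdp \<Rightarrow> real ^ 'o ^ 'a \<Rightarrow> real ^ ('s \<times> 'a) ^ ('s \<times> 'a)" where
  "state_action_kernel M \<pi> =
     (\<chi> z' z. transition M $ fst z' $ z * (\<pi> ** observation M) $ snd z' $ fst z')"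

definition state_action_freq ::
    "('s::finite, 'o::finite, 'a::finite) pomdp \<Rightarrow> real \<Rightarrow> real ^ 's \<Rightarrow> real ^ 'o ^ 'a \<Rightarrow> real ^ ('s \<times> 'a)"
  where
  "state_action_freq M \<gamma> \<mu> \<pi> =
     (1 - \<gamma>) *\<^sub>R (\<Sum>t. \<gamma> ^ t *\<^sub>R (matrix_power (state_action_kernel M \<pi>) t
                                *v joint_distribution \<mu> (\<pi> ** observation M)))"

definition linear_constraints ::
    "('s::finite, 'o::finite, 'a::finite) pomdp \<Rightarrow> real \<Rightarrow> real ^ 's \<Rightarrow> (real ^ ('s \<times> 'a)) set" where
  "linear_constraints M \<gamma> \<mu> =
     {\<eta>. \<forall>s. (\<Sum>a\<in>UNIV. \<eta> $ (s, a))
            - \<gamma> * (\<Sum>s'\<in>UNIV. \<Sum>a'\<in>UNIV. \<eta> $ (s', a') * transition M $ s $ (s', a'))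
            - (1 - \<gamma>) * \<mu> $ s = 0}"

definition quadratic_constraints ::
    "('s::finite \<Rightarrow> 'o::finite) \<Rightarrow> (real ^ ('s \<times> 'a::finite)) set" where
  "quadratic_constraints g =
     {\<eta>. \<forall>a a' s s'. g s = g s' \<longrightarrow>
            \<eta> $ (s, a) * \<eta> $ (s', a') - \<eta> $ (s, a') * \<eta> $ (s', a) = 0}"

end

theory Submission
  imports Defs
begin

text \<open>
  The discounted frequency of a policy is the unique solution \<open>\<eta>\<close> of the affine fixed-point
  equation \<open>\<eta> = (1 - \<gamma>) v + \<gamma> P \<eta>\<close>, where \<open>v\<close> is the initial state-action distribution and
  \<open>P\<close> the state-action kernel: the Neumann series solves the equation, and a column-stochastic
  matrix does not increase the \<open>l\<^sup>1\<close> norm, so that \<open>\<gamma> < 1\<close> leaves no second solution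
  (\<open>eq_discounted_occupancy_iff\<close>). Since \<open>v\<close> and \<open>P\<close> both factor through the policy, and since
  \<open>\<beta>\<close> is the map \<open>g\<close>, the equation reads, entry by entry,
  \<open>\<eta>(s,a) = \<pi>(a | g s) ((1 - \<gamma>) \<mu>(s) + \<gamma> (\<Sum>z. \<alpha>(s | z) \<eta>(z)))\<close>.

  Summing over the actions, the bracket must be the state marginal \<open>\<rho>(s) = (\<Sum>a. \<eta>(s,a))\<close>. So
  the equation splits into two independent parts (\<open>eq_state_action_freq_iff\<close>): the linear
  constraints, which do not mention the policy, and the factorization
  \<open>\<eta>(s,a) = \<pi>(a | g s) \<rho>(s)\<close>. The theorem thus amounts to describing the nonnegative \<open>\<eta>\<close>
  that factor in this way for \<^emph>\<open>some\<close> policy (\<open>factorization_iff_quadratic\<close>). For a fixed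
  observation \<open>o\<close>, the factorization says that the rows \<open>\<eta>(s,\<cdot>)\<close> with \<open>g s = o\<close> are all multiples
  of one row, which is to say that the \<open>2 \<times> 2\<close> minors of these rows vanish; these minors are the
  quadratic constraints. The policy is recovered by conditioning \<open>\<eta>\<close> on the observation,
  \<open>\<pi>(a | o) = (\<Sum>s | g s = o. \<eta>(s,a)) / (\<Sum>s | g s = o. \<rho>(s))\<close>
  at the observations of positive mass.
\<close>

section \<open>Discounted series of a stochastic matrix\<close>

lemma sum_UNIV_prod:
  fixes f :: "'a::finite \<times> 'b::finite \<Rightarrow> 'c::comm_monoid_add"
  shows "(\<Sum>z\<in>UNIV. f z) = (\<Sum>x\<in>UNIV. \<Sum>y\<in>UNIV. f (x, y))"
  by (simp add: sum.cartesian_product)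

lemma markov_kernelsD:
  fixes Q :: "real ^ 'x::finite ^ 'y::finite"
  assumes "Q \<in> markov_kernels"
  shows "0 \<le> Q $ y $ x" and "(\<Sum>y\<in>UNIV. Q $ y $ x) = 1"
  using assms by (auto simp: markov_kernels_def prob_simplex_def column_def)

lemma sum_markov_kernel_vector:
  fixes Q :: "real ^ 'x::finite ^ 'y::finite"
  assumes "Q \<in> markov_kernels"
  shows "(\<Sum>y\<in>UNIV. (Q *v p) $ y) = (\<Sum>x\<in>UNIV. p $ x)"
proof -
  have "(\<Sum>y\<in>UNIV. (Q *v p) $ y) = (\<Sum>x\<in>UNIV. \<Sum>y\<in>UNIV. Q $ y $ x * p $ x)"
    unfolding matrix_vector_mult_def by (simp add: sum.swap[of _ "UNIV :: 'x set"])
  also have "\<dots> = (\<Sum>x\<in>UNIV. p $ x)"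
    by (simp add: sum_distrib_right[symmetric] markov_kernelsD(2)[OF assms])
  finally show ?thesis .
qed

lemma markov_kernel_vector_in_simplex:
  fixes Q :: "real ^ 'x::finite ^ 'y::finite"
  assumes "Q \<in> markov_kernels" and "p \<in> prob_simplex"
  shows "Q *v p \<in> prob_simplex"
proof -
  have "0 \<le> (Q *v p) $ y" for y
    using assms(2) markov_kernelsD(1)[OF assms(1)]
    by (auto simp: matrix_vector_mult_def prob_simplex_def intro!: sum_nonneg)
  then show ?thesis
    using assms(2) sum_markov_kernel_vector[OF assms(1)] by (simp add: prob_simplex_def)
qed

lemma l1_norm_markov_kernel_le:
  fixes Q :: "real ^ 'x::finite ^ 'y::finite"
  assumes "Q \<in> markov_kernels"
  shows "(\<Sum>y\<in>UNIV. \<bar>(Q *v d) $ y\<bar>) \<le> (\<Sum>x\<in>UNIV. \<bar>d $ x\<bar>)"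
proof -
  have "\<bar>(Q *v d) $ y\<bar> \<le> (Q *v (\<chi> x. \<bar>d $ x\<bar>)) $ y" for y
    using markov_kernelsD(1)[OF assms]
    by (auto simp: matrix_vector_mult_def abs_mult intro!: order_trans[OF sum_abs] sum_mono)
  then have "(\<Sum>y\<in>UNIV. \<bar>(Q *v d) $ y\<bar>) \<le> (\<Sum>y\<in>UNIV. (Q *v (\<chi> x. \<bar>d $ x\<bar>)) $ y)"
    by (rule sum_mono)
  then show ?thesis
    by (simp add: sum_markov_kernel_vector[OF assms])
qed

lemma matrix_power_in_simplex:
  fixes P :: "real ^ 'n::finite ^ 'n"
  assumes "P \<in> markov_kernels" and "v \<in> prob_simplex"
  shows "matrix_power P t *v v \<in> prob_simplex"
proof (induction t)
  case 0
  then show ?case using assms(2) by simp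
next
  case (Suc t)
  then show ?case
    using markov_kernel_vector_in_simplex[OF assms(1)]
    by (simp add: matrix_vector_mul_assoc[symmetric])
qed

definition discounted_occupancy :: "real \<Rightarrow> real ^ 'n ^ 'n \<Rightarrow> real ^ 'n \<Rightarrow> real ^ 'n::finite" where
  "discounted_occupancy \<gamma> P v = (1 - \<gamma>) *\<^sub>R (\<Sum>t. \<gamma> ^ t *\<^sub>R (matrix_power P t *v v))"

lemma summable_discounted_occupancy:
  fixes P :: "real ^ 'n::finite ^ 'n"
  assumes "P \<in> markov_kernels" and "v \<in> prob_simplex" and "0 < \<gamma>" and "\<gamma> < 1"
  shows "summable (\<lambda>t. \<gamma> ^ t *\<^sub>R (matrix_power P t *v v))"
proof (rule summable_comparison_test'[where g = "\<lambda>t. \<gamma> ^ t"])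
  show "summable (\<lambda>t. \<gamma> ^ t)"
    using assms(3,4) by (simp add: summable_geometric)
next
  fix t :: nat
  let ?p = "matrix_power P t *v v"
  have "norm ?p \<le> (\<Sum>i\<in>UNIV. \<bar>?p $ i\<bar>)"
    by (rule norm_le_l1_cart)
  also have "\<dots> = 1"
    using matrix_power_in_simplex[OF assms(1,2), of t] by (simp add: prob_simplex_def)
  finally show "norm (\<gamma> ^ t *\<^sub>R ?p) \<le> \<gamma> ^ t"
    using assms(3) by (simp add: mult_left_le)
qed

text \<open>
  Splitting off the term \<open>t = 0\<close> of the Neumann series and taking one factor \<open>\<gamma> P\<close> out of the
  rest gives the series back.
\<close>

lemma discounted_occupancy_fixed_point:
  fixes P :: "real ^ 'n::finite ^ 'n"
  assumes "P \<in> markov_kernels" and "v \<in> prob_simplex" and "0 < \<gamma>" and "\<gamma> < 1"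
  shows "discounted_occupancy \<gamma> P v
    = (1 - \<gamma>) *\<^sub>R v + \<gamma> *\<^sub>R (P *v discounted_occupancy \<gamma> P v)"
proof -
  define f where "f t = \<gamma> ^ t *\<^sub>R (matrix_power P t *v v)" for t
  have f: "summable f"
    unfolding f_def by (rule summable_discounted_occupancy[OF assms])
  have lin: "bounded_linear (\<lambda>x. \<gamma> *\<^sub>R (P *v x))"
    by (intro bounded_linear_scaleR_right[THEN bounded_linear_compose]
        matrix_vector_mul_bounded_linear)
  have f0: "f 0 = v"
    by (simp add: f_def)
  have "f (Suc t) = \<gamma> *\<^sub>R (P *v f t)" for t
    by (simp add: f_def matrix_vector_mul_assoc[symmetric] matrix_vector_mult_scaleR)
  then have tail: "(\<Sum>t. f (Suc t)) = \<gamma> *\<^sub>R (P *v (\<Sum>t. f t))"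
    using bounded_linear.suminf[OF lin f] by simp
  have S: "(\<Sum>t. f t) = v + \<gamma> *\<^sub>R (P *v (\<Sum>t. f t))"
    using suminf_split_head[OF f] tail by (simp add: f0 diff_eq_eq add.commute)
  have D: "discounted_occupancy \<gamma> P v = (1 - \<gamma>) *\<^sub>R (\<Sum>t. f t)"
    by (simp add: discounted_occupancy_def f_def)
  show ?thesis
    unfolding D by (subst S) (simp add: scaleR_add_right matrix_vector_mult_scaleR mult.commute)
qed

text \<open>
  The difference \<open>d\<close> of two solutions satisfies \<open>d = \<gamma> P d\<close>, so its \<open>l\<^sup>1\<close> norm is at most \<open>\<gamma>\<close>
  times itself.
\<close>

lemma discounted_fixed_point_unique:
  fixes P :: "real ^ 'n::finite ^ 'n"
  assumes "P \<in> markov_kernels" and "0 < \<gamma>" and "\<gamma> < 1"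
    and x: "x = b + \<gamma> *\<^sub>R (P *v x)" and y: "y = b + \<gamma> *\<^sub>R (P *v y)"
  shows "x = y"
proof -
  define d where "d = x - y"
  define N where "N = (\<Sum>i\<in>UNIV. \<bar>d $ i\<bar>)"
  have d: "d = \<gamma> *\<^sub>R (P *v d)"
    unfolding d_def by (subst x, subst y) (simp add: matrix_vector_mult_diff_distrib algebra_simps)
  have "N = (\<Sum>i\<in>UNIV. \<bar>(\<gamma> *\<^sub>R (P *v d)) $ i\<bar>)"
    unfolding N_def by (subst d) (rule refl)
  also have "\<dots> = \<gamma> * (\<Sum>i\<in>UNIV. \<bar>(P *v d) $ i\<bar>)"
    using assms(2) by (simp add: abs_mult sum_distrib_left)
  also have "\<dots> \<le> \<gamma> * N"
    using l1_norm_markov_kernel_le[OF assms(1), of d] assms(2) by (simp add: N_def)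
  finally have "(1 - \<gamma>) * N \<le> 0"
    by (simp add: algebra_simps)
  then have "N \<le> 0"
    using assms(3) by (simp add: mult_le_0_iff)
  moreover have "0 \<le> N"
    by (simp add: N_def sum_nonneg)
  ultimately have "N = 0"
    by simp
  then have "d = 0"
    by (simp add: N_def sum_nonneg_eq_0_iff vec_eq_iff)
  then show ?thesis
    by (simp add: d_def)
qed

lemma eq_discounted_occupancy_iff:
  fixes P :: "real ^ 'n::finite ^ 'n"
  assumes "P \<in> markov_kernels" and "v \<in> prob_simplex" and "0 < \<gamma>" and "\<gamma> < 1"
  shows "x = discounted_occupancy \<gamma> P v \<longleftrightarrow> x = (1 - \<gamma>) *\<^sub>R v + \<gamma> *\<^sub>R (P *v x)"
  using discounted_occupancy_fixed_point[OF assms]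
    discounted_fixed_point_unique[OF assms(1,3,4)]
  by blast

lemma discounted_occupancy_in_simplex:
  fixes P :: "real ^ 'n::finite ^ 'n"
  assumes "P \<in> markov_kernels" and "v \<in> prob_simplex" and "0 < \<gamma>" and "\<gamma> < 1"
  shows "discounted_occupancy \<gamma> P v \<in> prob_simplex"
proof -
  let ?x = "discounted_occupancy \<gamma> P v"
  let ?f = "\<lambda>t. \<gamma> ^ t *\<^sub>R (matrix_power P t *v v)"
  have f: "summable ?f"
    by (rule summable_discounted_occupancy[OF assms])
  have "0 \<le> ?x $ i" for i
  proof -
    have "(\<Sum>t. ?f t) $ i = (\<Sum>t. ?f t $ i)"
      by (rule bounded_linear.suminf[OF bounded_linear_vec_nth f])
    moreover have "0 \<le> (\<Sum>t. ?f t $ i)"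
      using matrix_power_in_simplex[OF assms(1,2)] assms(3)
      by (intro suminf_nonneg bounded_linear.summable[OF bounded_linear_vec_nth f])
        (simp add: prob_simplex_def)
    ultimately show ?thesis
      using assms(4) by (simp add: discounted_occupancy_def)
  qed
  moreover have "(\<Sum>i\<in>UNIV. ?x $ i) = 1"
  proof -
    \<comment> \<open>Summing the fixed-point equation over the coordinates leaves a scalar equation whose only
      solution is \<open>1\<close>.\<close>
    have "(\<Sum>i\<in>UNIV. ?x $ i) = (1 - \<gamma>) * (\<Sum>i\<in>UNIV. v $ i) + \<gamma> * (\<Sum>i\<in>UNIV. (P *v ?x) $ i)"
      by (subst discounted_occupancy_fixed_point[OF assms])
        (simp add: sum.distrib sum_distrib_left)
    then have "(\<Sum>i\<in>UNIV. ?x $ i) = (1 - \<gamma>) + \<gamma> * (\<Sum>i\<in>UNIV. ?x $ i)"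
      using assms(2) by (simp add: sum_markov_kernel_vector[OF assms(1)] prob_simplex_def)
    then have "(1 - \<gamma>) * ((\<Sum>i\<in>UNIV. ?x $ i) - 1) = 0"
      by (simp add: algebra_simps)
    then show ?thesis
      using assms(4) by simp
  qed
  ultimately show ?thesis
    by (simp add: prob_simplex_def)
qed

section \<open>State-action frequencies\<close>

lemma matrix_mult_in_markov_kernels:
  fixes Q :: "real ^ 'x::finite ^ 'y::finite" and R :: "real ^ 'w::finite ^ 'x"
  assumes "Q \<in> markov_kernels" and "R \<in> markov_kernels"
  shows "Q ** R \<in> markov_kernels"
proof -
  have "column w (Q ** R) = Q *v column w R" for w
    by (simp add: vec_eq_iff column_def matrix_matrix_mult_def matrix_vector_mult_def)
  then show ?thesis
    using assms(2) markov_kernel_vector_in_simplex[OF assms(1)] by (simp add: markov_kernels_def)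
qed

lemma joint_distribution_in_simplex:
  fixes Q :: "real ^ 'x::finite ^ 'y::finite"
  assumes "p \<in> prob_simplex" and "Q \<in> markov_kernels"
  shows "joint_distribution p Q \<in> prob_simplex"
proof -
  have "(\<Sum>z\<in>UNIV. joint_distribution p Q $ z) = (\<Sum>x\<in>UNIV. p $ x * (\<Sum>y\<in>UNIV. Q $ y $ x))"
    unfolding sum_UNIV_prod by (simp add: joint_distribution_def sum_distrib_left)
  then show ?thesis
    using assms(1) markov_kernelsD[OF assms(2)]
    by (simp add: prob_simplex_def joint_distribution_def)
qed

text \<open>
  Each column of the state-action kernel is itself a joint distribution, of the next state and
  the action chosen there.
\<close>

lemma state_action_kernel_in_markov_kernels:
  assumes "is_pomdp M" and "\<pi> \<in> policies M"
  shows "state_action_kernel M \<pi> \<in> markov_kernels"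
proof -
  have "column z (state_action_kernel M \<pi>)
      = joint_distribution (column z (transition M)) (\<pi> ** observation M)" for z
    by (simp add: vec_eq_iff column_def state_action_kernel_def joint_distribution_def)
  moreover have "\<pi> ** observation M \<in> markov_kernels"
    using assms by (simp add: is_pomdp_def policies_def matrix_mult_in_markov_kernels)
  ultimately show ?thesis
    using assms(1) joint_distribution_in_simplex[where Q = "\<pi> ** observation M"]
    by (simp add: is_pomdp_def markov_kernels_def)
qed

lemma state_action_freq_eq_discounted_occupancy:
  "state_action_freq M \<gamma> \<mu> \<pi>
    = discounted_occupancy \<gamma> (state_action_kernel M \<pi>) (joint_distribution \<mu> (\<pi> ** observation M))"
  by (simp add: state_action_freq_def discounted_occupancy_def)

lemma policy_joint_distribution_in_simplex:
  assumes "is_pomdp M" and "\<pi> \<in> policies M" and "\<mu> \<in> prob_simplex"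
  shows "joint_distribution \<mu> (\<pi> ** observation M) \<in> prob_simplex"
  using assms
  by (simp add: is_pomdp_def policies_def joint_distribution_in_simplex matrix_mult_in_markov_kernels)

lemma state_action_freq_in_simplex:
  assumes "is_pomdp M" and "\<pi> \<in> policies M" and "\<mu> \<in> prob_simplex" and "0 < \<gamma>" and "\<gamma> < 1"
  shows "state_action_freq M \<gamma> \<mu> \<pi> \<in> prob_simplex"
  unfolding state_action_freq_eq_discounted_occupancy
  using assms
  by (intro discounted_occupancy_in_simplex state_action_kernel_in_markov_kernels
      policy_joint_distribution_in_simplex)

text \<open>
  Written out, the fixed-point equation says \<open>\<eta>(s,a) = \<tau>(a | s) F(s)\<close> with
  \<open>\<tau> = \<pi> \<circ> \<beta>\<close> and an inflow \<open>F(s)\<close> free of \<open>a\<close>. As \<open>\<tau>(\<cdot> | s)\<close> sums to \<open>1\<close>, summing over \<open>a\<close>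
  forces \<open>F(s)\<close> to be the state marginal of \<open>\<eta>\<close>, which is the linear constraint at \<open>s\<close>.
\<close>

lemma eq_state_action_freq_iff:
  assumes "is_pomdp M" and "\<pi> \<in> policies M" and "\<mu> \<in> prob_simplex" and "0 < \<gamma>" and "\<gamma> < 1"
  shows "\<eta> = state_action_freq M \<gamma> \<mu> \<pi> \<longleftrightarrow>
    \<eta> \<in> linear_constraints M \<gamma> \<mu> \<and>
    (\<forall>s a. \<eta> $ (s, a) = (\<pi> ** observation M) $ a $ s * (\<Sum>a'\<in>UNIV. \<eta> $ (s, a')))"
    (is "_ \<longleftrightarrow> _ \<and> ?factors")
proof -
  let ?\<tau> = "\<pi> ** observation M"
  define F where "F s = (1 - \<gamma>) * \<mu> $ s
    + \<gamma> * (\<Sum>s'\<in>UNIV. \<Sum>a'\<in>UNIV. \<eta> $ (s', a') * transition M $ s $ (s', a'))" for s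
  have linear: "\<eta> \<in> linear_constraints M \<gamma> \<mu> \<longleftrightarrow> (\<forall>s. (\<Sum>a\<in>UNIV. \<eta> $ (s, a)) = F s)"
    by (auto simp: linear_constraints_def F_def algebra_simps)
  have kernel: "(state_action_kernel M \<pi> *v \<eta>) $ (s, a)
      = ?\<tau> $ a $ s * (\<Sum>s'\<in>UNIV. \<Sum>a'\<in>UNIV. \<eta> $ (s', a') * transition M $ s $ (s', a'))" for s a
    unfolding matrix_vector_mult_def sum_UNIV_prod
    by (simp add: state_action_kernel_def sum_distrib_left mult_ac)
  have rhs: "((1 - \<gamma>) *\<^sub>R joint_distribution \<mu> ?\<tau> + \<gamma> *\<^sub>R (state_action_kernel M \<pi> *v \<eta>)) $ (s, a)
      = ?\<tau> $ a $ s * F s" for s a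
    unfolding F_def vector_add_component vector_scaleR_component kernel joint_distribution_def
    by (simp add: algebra_simps)
  have \<tau>: "(\<Sum>a\<in>UNIV. ?\<tau> $ a $ s) = 1" for s
    using assms(1,2)
    by (simp add: markov_kernelsD(2) matrix_mult_in_markov_kernels is_pomdp_def policies_def)
  have "\<eta> = state_action_freq M \<gamma> \<mu> \<pi> \<longleftrightarrow> \<eta> = (1 - \<gamma>) *\<^sub>R joint_distribution \<mu> ?\<tau>
      + \<gamma> *\<^sub>R (state_action_kernel M \<pi> *v \<eta>)"
    unfolding state_action_freq_eq_discounted_occupancy
    using assms
    by (intro eq_discounted_occupancy_iff state_action_kernel_in_markov_kernels
        policy_joint_distribution_in_simplex)
  also have "\<dots> \<longleftrightarrow> (\<forall>s a. \<eta> $ (s, a) = ?\<tau> $ a $ s * F s)"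
    unfolding vec_eq_iff[of \<eta>] split_paired_All rhs ..
  also have "\<dots> \<longleftrightarrow> \<eta> \<in> linear_constraints M \<gamma> \<mu> \<and> ?factors"
  proof
    assume eq: "\<forall>s a. \<eta> $ (s, a) = ?\<tau> $ a $ s * F s"
    have marginal: "(\<Sum>a\<in>UNIV. \<eta> $ (s, a)) = F s" for s
      by (simp add: eq[rule_format] sum_distrib_right[symmetric] \<tau>)
    show "\<eta> \<in> linear_constraints M \<gamma> \<mu> \<and> ?factors"
      unfolding linear marginal using eq by blast
  next
    assume "\<eta> \<in> linear_constraints M \<gamma> \<mu> \<and> ?factors"
    then show "\<forall>s a. \<eta> $ (s, a) = ?\<tau> $ a $ s * F s"
      unfolding linear by metis
  qed
  finally show ?thesis .
qed

section \<open>Deterministic observations and vanishing minors\<close>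

lemma deterministic_observation_policy:
  fixes \<pi> :: "real ^ 'o::finite ^ 'a::finite" and \<beta> :: "real ^ 's::finite ^ 'o"
  assumes "\<forall>x s. \<beta> $ x $ s \<in> {0, 1}" and "\<forall>x s. \<beta> $ x $ s = 1 \<longleftrightarrow> g s = x"
  shows "(\<pi> ** \<beta>) $ a $ s = \<pi> $ a $ g s"
proof -
  have "\<beta> $ x $ s = (if g s = x then 1 else 0)" for x
    using assms by (metis insertE singletonD)
  then show ?thesis
    by (simp add: matrix_matrix_mult_def if_distrib[of "\<lambda>c. _ * c"] cong: if_cong)
qed

text \<open>
  This is the statement that a nonnegative matrix has rank at most one if and only if its
  \<open>2 \<times> 2\<close> minors vanish, applied to each block of rows with a common observation. Vanishing
  minors make the rows of a block proportional, hence also proportional to their sum; normalized,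
  that sum is the distribution of actions at the observation.
\<close>

lemma factorization_iff_quadratic:
  fixes \<eta> :: "real ^ ('s::finite \<times> 'a::finite)" and g :: "'s \<Rightarrow> 'o::finite"
  assumes nonneg: "\<forall>z. 0 \<le> \<eta> $ z"
  shows "(\<exists>\<pi>::real^'o^'a\<in>markov_kernels.
      \<forall>s a. \<eta> $ (s, a) = \<pi> $ a $ g s * (\<Sum>a'\<in>UNIV. \<eta> $ (s, a')))
    \<longleftrightarrow> \<eta> \<in> quadratic_constraints g"
    (is "?factors \<longleftrightarrow> _")
proof
  assume ?factors
  then obtain \<pi> :: "real^'o^'a"
    where \<pi>: "\<forall>s a. \<eta> $ (s, a) = \<pi> $ a $ g s * (\<Sum>a'\<in>UNIV. \<eta> $ (s, a'))"
    by blast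
  define \<rho> where "\<rho> s = (\<Sum>a\<in>UNIV. \<eta> $ (s, a))" for s
  have "\<eta> $ (s, a) = \<pi> $ a $ g s * \<rho> s" for s a
    unfolding \<rho>_def by (rule \<pi>[rule_format])
  then show "\<eta> \<in> quadratic_constraints g"
    by (simp add: quadratic_constraints_def)
next
  assume quad: "\<eta> \<in> quadratic_constraints g"
  define \<rho> where "\<rho> s = (\<Sum>a\<in>UNIV. \<eta> $ (s, a))" for s
  define w where "w x = (\<Sum>s | g s = x. \<rho> s)" for x
  \<comment> \<open>On an observation without mass every row is zero, so any distribution of actions will do;
    the uniform one is taken.\<close>
  define \<pi> :: "real^'o^'a" where "\<pi> = (\<chi> a x. if w x = 0 then 1 / real CARD('a)
    else (\<Sum>s | g s = x. \<eta> $ (s, a)) / w x)"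
  have \<rho>_nonneg: "0 \<le> \<rho> s" for s
    using nonneg by (simp add: \<rho>_def sum_nonneg)
  then have w_nonneg: "0 \<le> w x" for x
    by (simp add: w_def sum_nonneg)
  have w_sum: "(\<Sum>a\<in>UNIV. \<Sum>s | g s = x. \<eta> $ (s, a)) = w x" for x
    unfolding w_def \<rho>_def by (rule sum.swap)
  have "\<pi> \<in> markov_kernels"
  proof -
    have "(\<Sum>a\<in>UNIV. \<pi> $ a $ x) = 1" for x
      by (cases "w x = 0") (simp_all add: \<pi>_def sum_divide_distrib[symmetric] w_sum)
    then show ?thesis
      using nonneg w_nonneg
      by (simp add: markov_kernels_def prob_simplex_def column_def \<pi>_def sum_nonneg)
  qed
  moreover have "\<eta> $ (s, a) = \<pi> $ a $ g s * \<rho> s" for s a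
  proof (cases "w (g s) = 0")
    case True
    then have "\<rho> s = 0"
      using \<rho>_nonneg by (simp add: w_def sum_nonneg_eq_0_iff)
    moreover from this have "\<eta> $ (s, a) = 0"
      using nonneg by (simp add: \<rho>_def sum_nonneg_eq_0_iff)
    ultimately show ?thesis
      by simp
  next
    case False
    \<comment> \<open>Summing the minors of the rows \<open>s\<close>, \<open>s'\<close> over the second column compares an entry of one
      row with the row sums.\<close>
    have "\<eta> $ (s, a) * \<rho> s' = \<rho> s * \<eta> $ (s', a)" if "g s' = g s" for s'
      using quad that
      by (simp add: \<rho>_def sum_distrib_left sum_distrib_right quadratic_constraints_def)
    then have "(\<Sum>s' | g s' = g s. \<eta> $ (s, a) * \<rho> s') = (\<Sum>s' | g s' = g s. \<rho> s * \<eta> $ (s', a))"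
      by (intro sum.cong) auto
    then have "\<eta> $ (s, a) * w (g s) = \<rho> s * (\<Sum>s' | g s' = g s. \<eta> $ (s', a))"
      by (simp add: w_def sum_distrib_left)
    then show ?thesis
      using False by (simp add: \<pi>_def field_simps)
  qed
  ultimately show ?factors
    unfolding \<rho>_def by blast
qed

section \<open>Feasible state-action frequencies\<close>

theorem theorem6:
  fixes M :: "('s::finite, 'o::finite, 'a::finite) pomdp"
    and \<gamma> :: real and \<mu> :: "real ^ 's" and g :: "'s \<Rightarrow> 'o"
  assumes pomdp: "is_pomdp M"
    and discount: "0 < \<gamma>" "\<gamma> < 1"
    and initial: "\<mu> \<in> prob_simplex"
    and deterministic: "\<forall>x s. observation M $ x $ s \<in> {0, 1}"
    and g: "\<forall>x s. observation M $ x $ s = 1 \<longleftrightarrow> g s = x"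
    and positivity: "\<forall>\<pi>\<in>policies M. \<forall>s. 0 < (\<Sum>a\<in>UNIV. state_action_freq M \<gamma> \<mu> \<pi> $ (s, a))"
  shows "state_action_freq M \<gamma> \<mu> ` policies M =
           linear_constraints M \<gamma> \<mu> \<inter> quadratic_constraints g \<inter> prob_simplex
       \<and> state_action_freq M \<gamma> \<mu> ` policies M =
           {\<eta>. (\<forall>s a. 0 \<le> \<eta> $ (s, a))
              \<and> (\<Sum>s\<in>UNIV. \<Sum>a\<in>UNIV. \<eta> $ (s, a)) - 1 = 0
              \<and> (\<forall>s. (\<Sum>a\<in>UNIV. \<eta> $ (s, a))
                     - \<gamma> * (\<Sum>s'\<in>UNIV. \<Sum>a'\<in>UNIV. \<eta> $ (s', a') * transition M $ s $ (s', a'))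
                     - (1 - \<gamma>) * \<mu> $ s = 0)
              \<and> (\<forall>a a' s s'. g s = g s' \<longrightarrow>
                     \<eta> $ (s, a) * \<eta> $ (s', a') - \<eta> $ (s, a') * \<eta> $ (s', a) = 0)}"
proof -
  let ?feasible = "state_action_freq M \<gamma> \<mu> ` policies M"
  note freq_iff = eq_state_action_freq_iff[OF pomdp _ initial discount,
      unfolded deterministic_observation_policy[OF deterministic g]]
  have "\<eta> \<in> ?feasible \<longleftrightarrow> \<eta> \<in> linear_constraints M \<gamma> \<mu> \<inter> quadratic_constraints g \<inter> prob_simplex"
    (is "_ \<longleftrightarrow> \<eta> \<in> ?L \<inter> ?X \<inter> _") for \<eta>
  proof (cases "\<eta> \<in> prob_simplex")
    case True
    then have nonneg: "\<forall>z. 0 \<le> \<eta> $ z"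
      by (simp add: prob_simplex_def)
    have "\<eta> \<in> ?feasible \<longleftrightarrow> \<eta> \<in> ?L \<and>
        (\<exists>\<pi>::real^'o^'a\<in>markov_kernels.
          \<forall>s a. \<eta> $ (s, a) = \<pi> $ a $ g s * (\<Sum>a'\<in>UNIV. \<eta> $ (s, a')))"
      using freq_iff[of _ \<eta>] by (auto simp: image_iff policies_def)
    also have "\<dots> \<longleftrightarrow> \<eta> \<in> ?L \<and> \<eta> \<in> ?X"
      by (simp only: factorization_iff_quadratic[OF nonneg])
    finally show ?thesis
      using True by simp
  next
    case False
    then show ?thesis
      using state_action_freq_in_simplex[OF pomdp _ initial discount] by auto
  qed
  then have "?feasible = linear_constraints M \<gamma> \<mu> \<inter> quadratic_constraints g \<inter> prob_simplex"
    by blast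
  then show ?thesis
    unfolding linear_constraints_def quadratic_constraints_def prob_simplex_def sum_UNIV_prod
    by auto
qed

end
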